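(* Let $R$ be a commutative ring with unity and $k,l\in\mathbb{N}$. Let $I_1,\ldots,I_k$ be mutually co-maximal ideals of $R$, each of which is contained in only finitely many maximal ideals, and let $I=\prod_{i=1}^{k} I_i$. Let $m_j\in\mathbb{N}$, $0\le j\le l$. Then the Chinese remainder reduction map $$\mathbb{PF}^{l,(m_0,\ldots,m_l)}_{I}\longrightarrow \mathbb{PF}^{l,(m_0,\ldots,m_l)}_{I_1}\times \mathbb{PF}^{l,(m_0,\ldots,m_l)}_{I_2}\times\cdots\times \mathbb{PF}^{l,(m_0,\ldots,m_l)}_{I_k}$$ is surjective (in fact bijective). In particular, let $I_1,\ldots,I_k$ be pairwise co-maximal ideals of $R$ such that for each $1\le i\le k$ either $I_i=R$ or $I_i=Q_{i1}Q_{i2}\cdots Q_{ir_i}$, where the $Q_{ij}$ are ideals with $\mathrm{rad}(Q_{ij})=M_{ij}$ and the $M_{ij}$ ($1\le j\le r_i$, $1\le i\le k$) are distinct maximal ideals of $R$. Let $I=\prod_{i=1}^k I_i$. Then the Chinese remainder reduction map $$\mathbb{PF}^{l,(m_0,\ldots,m_l)}_{I}\longrightarrow \mathbb{PF}^{l,(m_0,\ldots,m_l)}_{I_1}\times\cdots\times \mathbb{PF}^{l,(m_0,\ldots,m_l)}_{I_k}$$ is surjective (in fact bijective).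
   Context: $\mathbb{N}$ denotes the positive integers. Ideals $I_1,\ldots,I_k$ are mutually (pairwise) co-maximal if $I_i+I_j=R$ for all $i\ne j$; the unit ideal $R$ is allowed among them. For a commutative ring $R$ with unity and $l\in\mathbb{N}$, let $\mathcal{GCD}_{l+1}(R)=\{(a_0,\ldots,a_l)\in R^{l+1} : \sum_{i=0}^{l}(a_i)=R\}$, where $(a)$ is the principal ideal generated by $a$. For a proper ideal $I\subsetneq R$ and $m_0,\ldots,m_l\in\mathbb{N}$, define an equivalence relation on $\mathcal{GCD}_{l+1}(R)$ by $(a_0,\ldots,a_l)\sim(b_0,\ldots,b_l)$ iff there is $\lambda\in R$ whose image in $R/I$ is a unit such that $a_i\equiv\lambda^{m_i}b_i \bmod I$ for all $0\le i\le l$. If $I=R$, any two elements are declared equivalent. The generalized projective space $\mathbb{PF}^{l,(m_0,\ldots,m_l)}_{I}$ is the quotient set of $\mathcal{GCD}_{l+1}(R)$ by this relation (a singleton if $I=R$); the class of $(a_0,\ldots,a_l)$ is written $[a_0:\cdots:a_l]$. The Chinese remainder reduction map sends the class $[a_0:\cdots:a_l]$ modulo $I$ to the tuple of classes of the same vector $(a_0,\ldots,a_l)$ modulo $I_1,\ldots,I_k$. *)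

theory Defs
  imports "HOL-Algebra.QuotRing" "HOL-Algebra.Ideal_Product"
begin

text \<open>
  Vectors \<open>(a\<^sub>0, \<dots>, a\<^sub>l)\<close> are extensional functions on \<open>{0..l}\<close>. Finite sums and products of
  ideals are \<^const>\<open>finsum\<close> and \<^const>\<open>finprod\<close> in the commutative semiring \<^term>\<open>ideals_set R\<close>
  of ideals of \<open>R\<close>, whose one is the unit ideal.
\<close>

definition unimodular_vectors :: "('a, 'b) ring_scheme \<Rightarrow> nat \<Rightarrow> (nat \<Rightarrow> 'a) set"
  where "unimodular_vectors R l =
    {a \<in> {0..l} \<rightarrow>\<^sub>E carrier R.
       (\<Oplus>\<^bsub>ideals_set R\<^esub> i \<in> {0..l}. PIdl\<^bsub>R\<^esub> (a i)) = carrier R}"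

definition proj_rel ::
    "('a, 'b) ring_scheme \<Rightarrow> nat \<Rightarrow> (nat \<Rightarrow> nat) \<Rightarrow> 'a set \<Rightarrow> ((nat \<Rightarrow> 'a) \<times> (nat \<Rightarrow> 'a)) set"
  where "proj_rel R l m I =
    {(a, b) \<in> unimodular_vectors R l \<times> unimodular_vectors R l.
       I = carrier R \<or>
       (\<exists>u \<in> carrier R. I +>\<^bsub>R\<^esub> u \<in> Units (R Quot I) \<and>
          (\<forall>i \<in> {0..l}. a i \<ominus>\<^bsub>R\<^esub> (u [^]\<^bsub>R\<^esub> m i) \<otimes>\<^bsub>R\<^esub> b i \<in> I))}"

definition proj_space ::
    "('a, 'b) ring_scheme \<Rightarrow> nat \<Rightarrow> (nat \<Rightarrow> nat) \<Rightarrow> 'a set \<Rightarrow> (nat \<Rightarrow> 'a) set set"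
  where "proj_space R l m I = unimodular_vectors R l // proj_rel R l m I"

text \<open>
  The class \<open>c\<close> is sent to the family of classes of its representatives. The union over all
  representatives collapses to a single class because the choice does not matter; see
  \<open>crt_reduction_class\<close> below.
\<close>

definition crt_reduction ::
    "('a, 'b) ring_scheme \<Rightarrow> nat \<Rightarrow> (nat \<Rightarrow> nat) \<Rightarrow> nat \<Rightarrow> (nat \<Rightarrow> 'a set)
      \<Rightarrow> (nat \<Rightarrow> 'a) set \<Rightarrow> nat \<Rightarrow> (nat \<Rightarrow> 'a) set"
  where "crt_reduction R l m k I c =
    (\<lambda>i \<in> {1..k}. \<Union>a \<in> c. proj_rel R l m (I i) `` {a})"

definition radical :: "('a, 'b) ring_scheme \<Rightarrow> 'a set \<Rightarrow> 'a set"
  where "radical R I = {x \<in> carrier R. \<exists>n::nat. n \<ge> 1 \<and> x [^]\<^bsub>R\<^esub> n \<in> I}"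

context cring
begin

lemma minus_mem_iff_rcos_eq:
  assumes "ideal I R" "x \<in> carrier R" "y \<in> carrier R"
  shows "x \<ominus> y \<in> I \<longleftrightarrow> I +> x = I +> y"
proof -
  interpret I: ideal I R by (rule assms(1))
  have "x \<ominus> y \<in> I \<longleftrightarrow> x \<in> I +> y"
    using I.a_rcos_module_minus[OF ring_axioms assms(3,2)] by simp
  also have "\<dots> \<longleftrightarrow> I +> x = I +> y"
    using I.a_repr_independence'[of x y] I.a_repr_independenceD[of x y] assms(2,3) by metis
  finally show ?thesis .
qed

lemma carrier_Quot_repr:
  assumes "w \<in> carrier (R Quot I)"
  shows "\<exists>v \<in> carrier R. w = I +> v"
  using assms unfolding FactRing_def A_RCOSETS_def' by auto

lemma equiv_proj_rel:
  assumes I: "ideal I R"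
  shows "equiv (unimodular_vectors R l) (proj_rel R l m I)"
proof -
  interpret I: ideal I R by (rule I)
  interpret Q: cring "R Quot I" by (rule I.quotient_is_cring[OF is_cring])
  interpret h: ring_hom_cring R "R Quot I" "(+>) I"
    by (rule I.rcos_ring_hom_cring[OF is_cring])
  have carr: "a i \<in> carrier R" if "a \<in> unimodular_vectors R l" "i \<in> {0..l}" for a i
    using that by (auto simp: unimodular_vectors_def)
  have hpow: "I +> (u [^] n) = (I +> u) [^]\<^bsub>R Quot I\<^esub> n" if "u \<in> carrier R" for u and n :: nat
    using that by (induction n) simp_all
  have rel: "(a, b) \<in> proj_rel R l m I \<longleftrightarrow>
      a \<in> unimodular_vectors R l \<and> b \<in> unimodular_vectors R l \<and>
      (I = carrier R \<or> (\<exists>u \<in> carrier R. I +> u \<in> Units (R Quot I) \<and>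
        (\<forall>i \<in> {0..l}. I +> a i = (I +> u) [^]\<^bsub>R Quot I\<^esub> m i \<otimes>\<^bsub>R Quot I\<^esub> (I +> b i))))" for a b
  proof -
    have "a i \<ominus> (u [^] m i) \<otimes> b i \<in> I \<longleftrightarrow>
        I +> a i = (I +> u) [^]\<^bsub>R Quot I\<^esub> m i \<otimes>\<^bsub>R Quot I\<^esub> (I +> b i)"
      if "a \<in> unimodular_vectors R l" "b \<in> unimodular_vectors R l" "u \<in> carrier R" "i \<in> {0..l}" for u i
      using that carr[of a i] carr[of b i] minus_mem_iff_rcos_eq[OF I]
      by (simp add: hpow)
    then show ?thesis by (auto simp: proj_rel_def)
  qed
  show ?thesis
  proof (rule equivI)
    show "proj_rel R l m I \<subseteq> unimodular_vectors R l \<times> unimodular_vectors R l"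
      by (auto simp: proj_rel_def)
    show "refl_on (unimodular_vectors R l) (proj_rel R l m I)"
    proof (rule refl_onI)
      fix a assume a: "a \<in> unimodular_vectors R l"
      have "I +> a i = (I +> \<one>) [^]\<^bsub>R Quot I\<^esub> m i \<otimes>\<^bsub>R Quot I\<^esub> (I +> a i)" if "i \<in> {0..l}" for i
        using carr[OF a that] by (simp add: Q.nat_pow_one)
      then show "(a, a) \<in> proj_rel R l m I"
        using a unfolding rel by (metis h.hom_one Q.Units_one_closed one_closed)
    qed
    show "sym (proj_rel R l m I)"
    proof (rule symI)
      fix a b assume ab: "(a, b) \<in> proj_rel R l m I"
      show "(b, a) \<in> proj_rel R l m I"
      proof (cases "I = carrier R")
        case True then show ?thesis using ab unfolding rel by blast
      next
        case False
        then obtain u where u: "u \<in> carrier R" "I +> u \<in> Units (R Quot I)"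
          and eq: "\<And>i. i \<in> {0..l} \<Longrightarrow>
            I +> a i = (I +> u) [^]\<^bsub>R Quot I\<^esub> m i \<otimes>\<^bsub>R Quot I\<^esub> (I +> b i)"
          and a: "a \<in> unimodular_vectors R l" and b: "b \<in> unimodular_vectors R l"
          using ab unfolding rel by blast
        have "inv\<^bsub>R Quot I\<^esub> (I +> u) \<in> carrier (R Quot I)" using u by simp
        then obtain v where v: "v \<in> carrier R" "inv\<^bsub>R Quot I\<^esub> (I +> u) = I +> v"
          using carrier_Quot_repr by blast
        have vU: "I +> v \<in> Units (R Quot I)" using u v Q.Units_inv_Units by metis
        have vu: "(I +> v) \<otimes>\<^bsub>R Quot I\<^esub> (I +> u) = \<one>\<^bsub>R Quot I\<^esub>"
          using u v Q.Units_l_inv by metis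
        have "I +> b i = (I +> v) [^]\<^bsub>R Quot I\<^esub> m i \<otimes>\<^bsub>R Quot I\<^esub> (I +> a i)" if i: "i \<in> {0..l}" for i
        proof -
          have c: "I +> b i \<in> carrier (R Quot I)" "I +> u \<in> carrier (R Quot I)" "I +> v \<in> carrier (R Quot I)"
            using carr[OF b i] u v by auto
          have "(I +> v) [^]\<^bsub>R Quot I\<^esub> m i \<otimes>\<^bsub>R Quot I\<^esub> (I +> a i)
              = ((I +> v) \<otimes>\<^bsub>R Quot I\<^esub> (I +> u)) [^]\<^bsub>R Quot I\<^esub> m i \<otimes>\<^bsub>R Quot I\<^esub> (I +> b i)"
            using c by (simp only: eq[OF i] Q.nat_pow_distrib Q.m_assoc Q.nat_pow_closed)
          then show ?thesis using c by (simp only: vu Q.nat_pow_one Q.l_one)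
        qed
        then show ?thesis using a b v(1) vU unfolding rel by blast
      qed
    qed
    show "trans (proj_rel R l m I)"
    proof (rule transI)
      fix a b c assume ab: "(a, b) \<in> proj_rel R l m I" and bc: "(b, c) \<in> proj_rel R l m I"
      show "(a, c) \<in> proj_rel R l m I"
      proof (cases "I = carrier R")
        case True then show ?thesis using ab bc unfolding rel by blast
      next
        case False
        obtain u where u: "u \<in> carrier R" "I +> u \<in> Units (R Quot I)"
          and equ: "\<And>i. i \<in> {0..l} \<Longrightarrow>
            I +> a i = (I +> u) [^]\<^bsub>R Quot I\<^esub> m i \<otimes>\<^bsub>R Quot I\<^esub> (I +> b i)"
          and a: "a \<in> unimodular_vectors R l"
          using ab False unfolding rel by blast
        obtain v where v: "v \<in> carrier R" "I +> v \<in> Units (R Quot I)"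
          and eqv: "\<And>i. i \<in> {0..l} \<Longrightarrow>
            I +> b i = (I +> v) [^]\<^bsub>R Quot I\<^esub> m i \<otimes>\<^bsub>R Quot I\<^esub> (I +> c i)"
          and c: "c \<in> unimodular_vectors R l"
          using bc False unfolding rel by blast
        have "I +> a i = (I +> (u \<otimes> v)) [^]\<^bsub>R Quot I\<^esub> m i \<otimes>\<^bsub>R Quot I\<^esub> (I +> c i)" if i: "i \<in> {0..l}" for i
        proof -
          have cc: "I +> c i \<in> carrier (R Quot I)" "I +> u \<in> carrier (R Quot I)" "I +> v \<in> carrier (R Quot I)"
            using carr[OF c i] u v by auto
          show ?thesis
            using cc u v by (simp only: equ[OF i] eqv[OF i] h.hom_mult Q.nat_pow_distrib Q.m_assoc Q.nat_pow_closed)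
        qed
        moreover have "I +> (u \<otimes> v) \<in> Units (R Quot I)" using u v by simp
        ultimately show ?thesis using a c u v unfolding rel by blast
      qed
    qed
  qed
qed

lemma finprod_ideals_is_ideal:
  assumes "finite A" "\<And>i. i \<in> A \<Longrightarrow> ideal (I i) R"
  shows "ideal (\<Otimes>\<^bsub>ideals_set R\<^esub> i \<in> A. I i) R"
proof -
  interpret S: comm_monoid "ideals_set R" by (rule ideals_set_is_comm_monoid)
  have "(\<Otimes>\<^bsub>ideals_set R\<^esub> i \<in> A. I i) \<in> carrier (ideals_set R)"
    by (rule S.finprod_closed) (use assms in \<open>auto simp: ideals_set_def\<close>)
  then show ?thesis by (simp add: ideals_set_def)
qed

lemma finprod_ideals_subset:
  assumes "finite A" "\<And>i. i \<in> A \<Longrightarrow> ideal (I i) R" "j \<in> A"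
  shows "(\<Otimes>\<^bsub>ideals_set R\<^esub> i \<in> A. I i) \<subseteq> I j"
proof -
  interpret S: comm_monoid "ideals_set R" by (rule ideals_set_is_comm_monoid)
  let ?P = "\<Otimes>\<^bsub>ideals_set R\<^esub> i \<in> A - {j}. I i"
  have P: "ideal ?P R" by (rule finprod_ideals_is_ideal) (use assms in auto)
  have "(\<Otimes>\<^bsub>ideals_set R\<^esub> i \<in> insert j (A - {j}). I i) = I j \<otimes>\<^bsub>ideals_set R\<^esub> ?P"
    by (rule S.finprod_insert) (use assms in \<open>auto simp: ideals_set_def\<close>)
  then have "(\<Otimes>\<^bsub>ideals_set R\<^esub> i \<in> A. I i) = I j \<cdot> ?P"
    using assms(3) by (simp add: insert_absorb ideals_set_def)
  then show ?thesis using ideal_prod_inter[OF assms(2)[OF assms(3)] P] by blast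
qed

lemma Units_Quot_mono:
  assumes I: "ideal I R" and J: "ideal J R" and "I \<subseteq> J" "u \<in> carrier R"
    and U: "I +> u \<in> Units (R Quot I)"
  shows "J +> u \<in> Units (R Quot J)"
proof -
  interpret hI: ring_hom_cring R "R Quot I" "(+>) I"
    by (rule ideal.rcos_ring_hom_cring[OF I is_cring])
  interpret hJ: ring_hom_cring R "R Quot J" "(+>) J"
    by (rule ideal.rcos_ring_hom_cring[OF J is_cring])
  obtain w where w: "w \<in> carrier (R Quot I)" "w \<otimes>\<^bsub>R Quot I\<^esub> (I +> u) = \<one>\<^bsub>R Quot I\<^esub>"
    using U unfolding Units_def by blast
  then obtain v where v: "v \<in> carrier R" "w = I +> v"
    using carrier_Quot_repr by blast
  have vu: "v \<otimes> u \<in> carrier R" by (rule m_closed[OF v(1) assms(4)])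
  have "I +> (v \<otimes> u) = I +> \<one>"
    by (simp only: hI.hom_mult[OF v(1) assms(4)] hI.hom_one w(2)[unfolded v(2)])
  then have "v \<otimes> u \<ominus> \<one> \<in> J"
    using minus_mem_iff_rcos_eq[OF I vu one_closed] assms(3) by blast
  then have eq: "J +> (v \<otimes> u) = J +> \<one>"
    using minus_mem_iff_rcos_eq[OF J vu one_closed] by blast
  have 1: "(J +> v) \<otimes>\<^bsub>R Quot J\<^esub> (J +> u) = \<one>\<^bsub>R Quot J\<^esub>"
    by (simp only: hJ.hom_mult[OF v(1) assms(4), symmetric] eq hJ.hom_one)
  moreover have "(J +> u) \<otimes>\<^bsub>R Quot J\<^esub> (J +> v) = \<one>\<^bsub>R Quot J\<^esub>"
    using 1 hJ.S.m_comm[OF hJ.hom_closed[OF v(1)] hJ.hom_closed[OF assms(4)]] by (simp only:)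
  ultimately show ?thesis
    unfolding Units_def using v(1) assms(4) hJ.hom_closed by blast
qed

lemma proj_rel_mono:
  assumes I: "ideal I R" and J: "ideal J R" and IJ: "I \<subseteq> J"
  shows "proj_rel R l m I \<subseteq> proj_rel R l m J"
proof (cases "J = carrier R")
  case True
  then show ?thesis by (auto simp: proj_rel_def)
next
  case False
  then have "I \<noteq> carrier R"
    using IJ ideal.axioms(1)[OF J, THEN additive_subgroup.a_subset] by blast
  then show ?thesis
    using False Units_Quot_mono[OF I J IJ] IJ unfolding proj_rel_def by blast
qed

lemma crt_reduction_class:
  assumes I: "\<And>i. i \<in> {1..k} \<Longrightarrow> ideal (I i) R" and a: "a \<in> unimodular_vectors R l"
  shows "crt_reduction R l m k I (proj_rel R l m (\<Otimes>\<^bsub>ideals_set R\<^esub> i \<in> {1..k}. I i) `` {a})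
    = (\<lambda>i \<in> {1..k}. proj_rel R l m (I i) `` {a})"
proof -
  let ?P = "\<Otimes>\<^bsub>ideals_set R\<^esub> i \<in> {1..k}. I i"
  have P: "ideal ?P R" by (rule finprod_ideals_is_ideal) (use I in auto)
  have "(\<Union>b \<in> proj_rel R l m ?P `` {a}. proj_rel R l m (I i) `` {b}) = proj_rel R l m (I i) `` {a}"
    if i: "i \<in> {1..k}" for i
  proof -
    have sub: "proj_rel R l m ?P \<subseteq> proj_rel R l m (I i)"
      by (rule proj_rel_mono[OF P I[OF i]], rule finprod_ideals_subset) (use I i in auto)
    have "proj_rel R l m (I i) `` {b} = proj_rel R l m (I i) `` {a}"
      if "b \<in> proj_rel R l m ?P `` {a}" for b
      using equiv_class_eq[OF equiv_proj_rel[OF I[OF i]], of a b] sub that by blast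
    moreover have "a \<in> proj_rel R l m ?P `` {a}"
      using equiv_class_self[OF equiv_proj_rel[OF P] a] .
    ultimately show ?thesis by blast
  qed
  then show ?thesis unfolding crt_reduction_def by (intro restrict_ext) auto
qed

end

end

theory Submission
  imports Defs "HOL-Algebra.Ring_Divisibility"
begin

text \<open>
  Everything rests on looking at maximal ideals only. An element is a unit modulo \<open>I\<close> exactly
  when it lies in no maximal ideal above \<open>I\<close>, a vector is unimodular exactly when no maximal ideal
  contains all its entries, and a maximal ideal above a finite product of ideals is above one of
  the factors. So both conditions can be checked modulo each \<open>I\<^sub>i\<close> separately.

  Injectivity is then the Chinese remainder theorem for the scalars: if \<open>a\<close> and \<open>b\<close> are related
  modulo each \<open>I\<^sub>i\<close> through \<open>u\<^sub>i\<close>, an element \<open>u\<close> congruent to each \<open>u\<^sub>i\<close> is a unit modulo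
  the product \<open>I\<close>, and the congruences modulo all \<open>I\<^sub>i\<close> combine since the product of comaximal
  ideals is their intersection (\<open>proj_rel_finprod_iff\<close>).

  For surjectivity, the Chinese remainder theorem for the coordinates glues representatives
  modulo the \<open>I\<^sub>i\<close> to a vector \<open>b\<close> that is unimodular modulo \<open>I\<close>, but perhaps not over \<open>R\<close>.
  The crux is to replace \<open>b\<close> by a congruent vector that is unimodular over \<open>R\<close>
  (\<open>unimodular_vector_lift\<close>), and here the finiteness hypothesis enters: as only finitely many
  maximal ideals lie above \<open>I\<close>, some \<open>u = b\<^sub>0 + y\<close> with \<open>y \<in> (b\<^sub>1, \<dots>, b\<^sub>l)\<close> is a unit modulo \<open>I\<close>
  (\<open>avoid_finitely_many_maximalideals\<close>). This amounts to an elementary transformation taking \<open>b\<close> to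
  \<open>(u, b\<^sub>1, \<dots>, b\<^sub>l)\<close>; a second one, available since \<open>l \<ge> 1\<close>, turns \<open>b\<^sub>1\<close> into \<open>1\<close> modulo \<open>I\<close>.
  A vector with an entry \<open>1\<close> is unimodular over \<open>R\<close>, and undoing the two transformations over \<open>R\<close>
  keeps it so.

  In the second statement a maximal ideal above \<open>I\<^sub>i\<close> contains some \<open>Q\<^sub>i\<^sub>j\<close>, hence its radical
  \<open>M\<^sub>i\<^sub>j\<close>, and so equals \<open>M\<^sub>i\<^sub>j\<close>. Thus only finitely many maximal ideals lie above \<open>I\<^sub>i\<close>, and the
  first statement applies.
\<close>

context cring
begin

section \<open>Maximal ideals\<close>

text \<open>
  Zorn's lemma on the ideals above \<open>J\<close> that avoid \<open>\<one>\<close>: this condition, unlike being different from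
  the carrier, visibly passes to the union of a chain.
\<close>

lemma exists_maximalideal_above:
  assumes J: "ideal J R" and proper: "J \<noteq> carrier R"
  obtains M where "maximalideal M R" "J \<subseteq> M"
proof -
  define S where "S = {K. ideal K R \<and> J \<subseteq> K \<and> \<one> \<notin> K}"
  have "\<exists>M \<in> S. \<forall>K \<in> S. M \<subseteq> K \<longrightarrow> K = M"
  proof (rule subset_Zorn)
    fix C assume C: "subset.chain S C"
    show "\<exists>U \<in> S. \<forall>K \<in> C. K \<subseteq> U"
    proof (cases "C = {}")
      case True
      then show ?thesis
        using J proper ideal.one_imp_carrier[OF J] by (auto simp: S_def)
    next
      case False
      have CS: "C \<subseteq> S" using C by (simp add: pred_on.chain_def)
      have "subset.chain {K. ideal K R} C"
        using C unfolding pred_on.chain_def S_def by blast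
      then have "ideal (\<Union>C) R"
        using chain_Union_is_ideal[of C] False by simp
      then have "\<Union>C \<in> S" using CS False unfolding S_def by blast
      then show ?thesis by blast
    qed
  qed
  then obtain M where M: "M \<in> S" "\<And>K. K \<in> S \<Longrightarrow> M \<subseteq> K \<Longrightarrow> K = M" by blast
  have "maximalideal M R"
  proof (rule maximalidealI)
    show "ideal M R" "carrier R \<noteq> M" using M(1) by (auto simp: S_def)
    fix K assume "ideal K R" "M \<subseteq> K"
    then show "K = M \<or> K = carrier R"
      using M ideal.one_imp_carrier[of K] unfolding S_def by blast
  qed
  then show thesis using M(1) that unfolding S_def by blast
qed

lemma one_notin_maximalideal: "maximalideal M R \<Longrightarrow> \<one> \<notin> M"
  using ideal.one_imp_carrier maximalideal.I_notcarr maximalideal.axioms(1) by metis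

lemma ideal_diff_cong:
  assumes "ideal I R" "x \<in> carrier R" "y \<in> carrier R" "x \<ominus> y \<in> I"
  shows "x \<in> I \<longleftrightarrow> y \<in> I"
proof -
  interpret I: ideal I R by fact
  have "x = (x \<ominus> y) \<oplus> y" "y = x \<ominus> (x \<ominus> y)" using assms(2,3) by algebra+
  then show ?thesis using assms(4) I.a_closed I.a_inv_closed unfolding a_minus_def by metis
qed

lemma Units_Quot_iff_inverse_mod:
  assumes I: "ideal I R" and u: "u \<in> carrier R"
  shows "I +> u \<in> Units (R Quot I) \<longleftrightarrow> (\<exists>v \<in> carrier R. \<one> \<ominus> v \<otimes> u \<in> I)"
proof -
  interpret h: ring_hom_cring R "R Quot I" "(+>) I"
    by (rule ideal.rcos_ring_hom_cring[OF I is_cring])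
  have eq: "\<one> \<ominus> v \<otimes> u \<in> I \<longleftrightarrow> (I +> v) \<otimes>\<^bsub>R Quot I\<^esub> (I +> u) = \<one>\<^bsub>R Quot I\<^esub>"
    if v: "v \<in> carrier R" for v
  proof -
    have vu: "v \<otimes> u \<in> carrier R" using u v by simp
    show ?thesis
      unfolding minus_mem_iff_rcos_eq[OF I one_closed vu] h.hom_mult[OF v u] h.hom_one
      by (rule eq_commute)
  qed
  show ?thesis
  proof
    assume "I +> u \<in> Units (R Quot I)"
    then obtain w where "w \<in> carrier (R Quot I)" "w \<otimes>\<^bsub>R Quot I\<^esub> (I +> u) = \<one>\<^bsub>R Quot I\<^esub>"
      unfolding Units_def by blast
    then show "\<exists>v \<in> carrier R. \<one> \<ominus> v \<otimes> u \<in> I"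
      using carrier_Quot_repr eq by metis
  next
    assume "\<exists>v \<in> carrier R. \<one> \<ominus> v \<otimes> u \<in> I"
    then obtain v where v: "v \<in> carrier R"
      "(I +> v) \<otimes>\<^bsub>R Quot I\<^esub> (I +> u) = \<one>\<^bsub>R Quot I\<^esub>" using eq by blast
    have "(I +> u) \<otimes>\<^bsub>R Quot I\<^esub> (I +> v) = \<one>\<^bsub>R Quot I\<^esub>"
      using v h.S.m_comm[OF h.hom_closed[OF v(1)] h.hom_closed[OF u]] by (simp only:)
    then show "I +> u \<in> Units (R Quot I)"
      unfolding Units_def using v h.hom_closed u by blast
  qed
qed

text \<open>
  If no maximal ideal contains both \<open>I\<close> and \<open>u\<close>, then \<open>I + (u)\<close> is the unit ideal, and writing \<open>\<one>\<close>
  in it yields an inverse of \<open>u\<close> modulo \<open>I\<close>.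
\<close>

lemma Units_Quot_iff_maximalideal:
  assumes I: "ideal I R" and u: "u \<in> carrier R"
  shows "I +> u \<in> Units (R Quot I) \<longleftrightarrow> (\<forall>M. maximalideal M R \<longrightarrow> I \<subseteq> M \<longrightarrow> u \<notin> M)"
    (is "?U \<longleftrightarrow> ?N")
proof
  assume ?U
  then obtain v where v: "v \<in> carrier R" "\<one> \<ominus> v \<otimes> u \<in> I"
    using Units_Quot_iff_inverse_mod[OF I u] by blast
  show ?N
  proof (intro allI impI notI)
    fix M assume M: "maximalideal M R" "I \<subseteq> M" "u \<in> M"
    interpret M: maximalideal M R by (rule M(1))
    have "v \<otimes> u \<in> M" using v(1) M(3) by (rule M.I_l_closed[rotated])
    then have "\<one> \<in> M"
      using ideal_diff_cong[OF M.ideal_axioms one_closed _, of "v \<otimes> u"] v u M(2) by auto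
    then show False using one_notin_maximalideal[OF M(1)] by blast
  qed
next
  assume N: ?N
  interpret I: ideal I R by (rule I)
  have P: "ideal (PIdl u) R" by (rule cgenideal_ideal[OF u])
  interpret P: ideal "PIdl u" R by (rule P)
  have S: "ideal (I <+> PIdl u) R" by (rule add_ideals[OF I P])
  have incl: "I \<subseteq> I <+> PIdl u" "u \<in> I <+> PIdl u"
  proof -
    show "I \<subseteq> I <+> PIdl u"
      using genideal_self[of "I \<union> PIdl u"] union_genideal[OF I P] I.a_subset P.a_subset by auto
    show "u \<in> I <+> PIdl u"
      using genideal_self[of "I \<union> PIdl u"] union_genideal[OF I P] I.a_subset P.a_subset
        cgenideal_self[OF u] by auto
  qed
  have "I <+> PIdl u = carrier R"
  proof (rule ccontr)
    assume "I <+> PIdl u \<noteq> carrier R"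
    then obtain M :: "'a set" where "maximalideal M R" "I <+> PIdl u \<subseteq> M"
      using exists_maximalideal_above[OF S] by blast
    then show False using N incl by blast
  qed
  then obtain x v where "x \<in> I" "v \<in> carrier R" "\<one> = x \<oplus> v \<otimes> u"
    using one_closed unfolding set_add_def' cgenideal_def by blast
  moreover from this u have "\<one> \<ominus> v \<otimes> u = x"
    using I.Icarr[of x] by algebra
  ultimately show ?U
    unfolding Units_Quot_iff_inverse_mod[OF I u] by metis
qed

section \<open>Chinese remaindering\<close>

lemma finprod_ideals_insert:
  assumes "finite A" "i \<notin> A" "\<And>j. j \<in> insert i A \<Longrightarrow> ideal (I j) R"
  shows "(\<Otimes>\<^bsub>ideals_set R\<^esub> j \<in> insert i A. I j) = I i \<cdot> (\<Otimes>\<^bsub>ideals_set R\<^esub> j \<in> A. I j)"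
proof -
  interpret S: comm_monoid "ideals_set R" by (rule ideals_set_is_comm_monoid)
  have "(\<Otimes>\<^bsub>ideals_set R\<^esub> j \<in> insert i A. I j)
      = I i \<otimes>\<^bsub>ideals_set R\<^esub> (\<Otimes>\<^bsub>ideals_set R\<^esub> j \<in> A. I j)"
    by (rule S.finprod_insert) (use assms in \<open>auto simp: ideals_set_def\<close>)
  then show ?thesis by (simp add: ideals_set_def)
qed

lemma finprod_ideals_empty: "(\<Otimes>\<^bsub>ideals_set R\<^esub> j \<in> {}. I j) = carrier R"
  using comm_monoid.finprod_empty[OF ideals_set_is_comm_monoid] by (simp add: ideals_set_def)

lemma primeideal_above_finprod:
  assumes "finite A" "\<And>j. j \<in> A \<Longrightarrow> ideal (I j) R" "primeideal P R"
    and "(\<Otimes>\<^bsub>ideals_set R\<^esub> j \<in> A. I j) \<subseteq> P"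
  shows "\<exists>j \<in> A. I j \<subseteq> P"
  using assms
proof (induction A rule: finite_induct)
  case empty
  then show ?case
    using primeideal.I_notcarr[OF empty(2)]
      additive_subgroup.a_subset[OF ideal.axioms(1)[OF primeideal.axioms(1)[OF empty(2)]]]
    by (simp add: finprod_ideals_empty)
next
  case (insert i A)
  have "ideal (\<Otimes>\<^bsub>ideals_set R\<^esub> j \<in> A. I j) R"
    by (rule finprod_ideals_is_ideal) (use insert in auto)
  moreover have "I i \<cdot> (\<Otimes>\<^bsub>ideals_set R\<^esub> j \<in> A. I j) \<subseteq> P"
    using insert.prems(3) finprod_ideals_insert[of A i I] insert.hyps insert.prems(1) by simp
  ultimately have "I i \<subseteq> P \<or> (\<Otimes>\<^bsub>ideals_set R\<^esub> j \<in> A. I j) \<subseteq> P"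
    using primeideal_divides_ideal_prod[OF insert.prems(2)] insert.prems(1) by simp
  then show ?case using insert.IH insert.prems by blast
qed

text \<open>
  A maximal ideal containing \<open>K\<close> and the product would contain \<open>K\<close> and one of the factors.
\<close>

lemma comaximal_finprod:
  assumes A: "finite A" "\<And>j. j \<in> A \<Longrightarrow> ideal (I j) R" and K: "ideal K R"
    and comax: "\<And>j. j \<in> A \<Longrightarrow> K <+> I j = carrier R"
  shows "K <+> (\<Otimes>\<^bsub>ideals_set R\<^esub> j \<in> A. I j) = carrier R"
proof (rule ccontr)
  let ?P = "\<Otimes>\<^bsub>ideals_set R\<^esub> j \<in> A. I j"
  assume neq: "K <+> ?P \<noteq> carrier R"
  have P: "ideal ?P R" by (rule finprod_ideals_is_ideal) (use A in auto)
  obtain M :: "'a set" where M: "maximalideal M R" "K <+> ?P \<subseteq> M"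
    using exists_maximalideal_above[OF add_ideals[OF K P] neq] by blast
  have KP: "K \<subseteq> carrier R" "?P \<subseteq> carrier R"
    using K P ideal.axioms(1) additive_subgroup.a_subset by blast+
  have "K \<union> ?P \<subseteq> M"
    using genideal_self[of "K \<union> ?P"] union_genideal[OF K P] KP M(2) by auto
  then obtain j where j: "j \<in> A" "I j \<subseteq> M"
    using primeideal_above_finprod[where I = I, OF A maximalideal_prime[OF M(1)]] \<open>K \<union> ?P \<subseteq> M\<close> by blast
  moreover have "K \<subseteq> M" using \<open>K \<union> ?P \<subseteq> M\<close> by blast
  ultimately have "K <+> I j \<subseteq> M"
    using genideal_minimal[OF maximalideal.axioms(1)[OF M(1)]] union_genideal[OF K A(2)[OF j(1)]]
    by blast
  then show False using comax[OF j(1)] one_notin_maximalideal[OF M(1)] one_closed by blast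
qed

lemma finprod_eq_INT:
  assumes "finite A" "\<And>j. j \<in> A \<Longrightarrow> ideal (I j) R"
    and "\<And>i j. i \<in> A \<Longrightarrow> j \<in> A \<Longrightarrow> i \<noteq> j \<Longrightarrow> I i <+> I j = carrier R"
  shows "(\<Otimes>\<^bsub>ideals_set R\<^esub> j \<in> A. I j) = carrier R \<inter> (\<Inter>j \<in> A. I j)"
  using assms
proof (induction A rule: finite_induct)
  case empty
  then show ?case by (simp add: finprod_ideals_empty)
next
  case (insert i A)
  have P: "ideal (\<Otimes>\<^bsub>ideals_set R\<^esub> j \<in> A. I j) R"
    by (rule finprod_ideals_is_ideal) (use insert in auto)
  have "I i <+> (\<Otimes>\<^bsub>ideals_set R\<^esub> j \<in> A. I j) = carrier R"
    by (rule comaximal_finprod) (use insert.hyps insert.prems in auto)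
  then have "I i \<cdot> (\<Otimes>\<^bsub>ideals_set R\<^esub> j \<in> A. I j) = I i \<inter> (\<Otimes>\<^bsub>ideals_set R\<^esub> j \<in> A. I j)"
    using ideal_prod_eq_inter[OF _ P] insert.prems(1) by simp
  moreover have "(\<Otimes>\<^bsub>ideals_set R\<^esub> j \<in> A. I j) = carrier R \<inter> (\<Inter>j \<in> A. I j)"
    by (rule insert.IH) (use insert.prems in auto)
  ultimately show ?case
    using insert.hyps insert.prems(1) finprod_ideals_insert[of A i I] by auto
qed

text \<open>
  Congruences are added one at a time: if \<open>b\<close> solves the congruences for \<open>A\<close> and
  \<open>\<one> = s \<oplus> e\<close> with \<open>s\<close> in the new ideal and \<open>e\<close> in the product of the old ones, then
  \<open>b \<oplus> e \<otimes> (x i \<ominus> b)\<close> keeps the old congruences and satisfies the new one.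
\<close>

lemma chinese_remainder_elements:
  assumes "finite A" "\<And>j. j \<in> A \<Longrightarrow> ideal (I j) R"
    and "\<And>i j. i \<in> A \<Longrightarrow> j \<in> A \<Longrightarrow> i \<noteq> j \<Longrightarrow> I i <+> I j = carrier R"
    and "\<And>j. j \<in> A \<Longrightarrow> x j \<in> carrier R"
  shows "\<exists>b \<in> carrier R. \<forall>j \<in> A. b \<ominus> x j \<in> I j"
  using assms
proof (induction A rule: finite_induct)
  case empty
  then show ?case by auto
next
  case (insert i A)
  let ?P = "\<Otimes>\<^bsub>ideals_set R\<^esub> j \<in> A. I j"
  have P: "ideal ?P R"
    by (rule finprod_ideals_is_ideal) (use insert in auto)
  obtain b where b: "b \<in> carrier R" "\<forall>j \<in> A. b \<ominus> x j \<in> I j"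
    using insert.IH insert.prems by auto
  have "I i <+> ?P = carrier R"
    by (rule comaximal_finprod) (use insert.hyps insert.prems in auto)
  then obtain s e where se: "s \<in> I i" "e \<in> ?P" "\<one> = s \<oplus> e"
    using one_closed unfolding set_add_def' by blast
  have xi: "x i \<in> carrier R" using insert.prems by simp
  interpret Ii: ideal "I i" R using insert.prems by simp
  have sc: "s \<in> carrier R" and ec: "e \<in> carrier R"
    using se Ii.Icarr ideal.Icarr[OF P] by auto
  let ?b = "b \<oplus> e \<otimes> (x i \<ominus> b)"
  have "?b \<ominus> x i = s \<otimes> (b \<ominus> x i)"
  proof -
    have "s = \<one> \<ominus> e" using se(3) sc ec by algebra
    then show ?thesis using b(1) xi ec by algebra
  qed
  then have "?b \<ominus> x i \<in> I i" using Ii.I_r_closed[OF se(1)] b(1) xi by simp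
  moreover have "?b \<ominus> x j \<in> I j" if j: "j \<in> A" for j
  proof -
    interpret Ij: ideal "I j" R using insert.prems j by simp
    have xj: "x j \<in> carrier R" using insert.prems j by simp
    have "e \<in> I j"
      using finprod_ideals_subset[of A I j] insert.hyps insert.prems j se(2) by auto
    then have "(b \<ominus> x j) \<oplus> e \<otimes> (x i \<ominus> b) \<in> I j"
      using Ij.I_r_closed b j xi by auto
    moreover have "?b \<ominus> x j = (b \<ominus> x j) \<oplus> e \<otimes> (x i \<ominus> b)"
      using b(1) xi ec xj by algebra
    ultimately show ?thesis by simp
  qed
  moreover have "?b \<in> carrier R" using b(1) ec xi by simp
  ultimately show ?case by blast
qed


section \<open>Unimodular vectors\<close>

text \<open>
  The sum of principal ideals in the definition is the smallest ideal containing the entries, and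
  it is the unit ideal unless it lies in a maximal ideal.
\<close>

lemma unimodular_vectors_iff:
  "a \<in> unimodular_vectors R l \<longleftrightarrow> a \<in> {0..l} \<rightarrow>\<^sub>E carrier R \<and>
    (\<forall>M. maximalideal M R \<longrightarrow> (\<exists>j \<in> {0..l}. a j \<notin> M))"
proof (cases "a \<in> {0..l} \<rightarrow>\<^sub>E carrier R")
  case True
  interpret S: semiring "ideals_set R" by (rule ideals_set_is_semiring)
  let ?S = "\<lambda>A. \<Oplus>\<^bsub>ideals_set R\<^esub> i \<in> A. PIdl (a i)"
  have P: "ideal (PIdl (a i)) R" if "i \<in> {0..l}" for i
    using True that by (intro cgenideal_ideal) auto
  have S: "ideal (?S A) R" if "A \<subseteq> {0..l}" for A
  proof -
    have "?S A \<in> carrier (ideals_set R)"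
      by (rule S.finsum_closed) (use P that in \<open>auto simp: ideals_set_def\<close>)
    then show ?thesis by (simp add: ideals_set_def)
  qed
  have below_iff: "?S A \<subseteq> K \<longleftrightarrow> (\<forall>i \<in> A. a i \<in> K)"
    if "A \<subseteq> {0..l}" "finite A" and K: "ideal K R" for A K
    using that(2,1)
  proof (induction A rule: finite_induct)
    case empty
    have "\<zero> \<in> K" using K by (simp add: ideal.axioms(1) additive_subgroup.zero_closed)
    moreover have "?S {} = {\<zero>}"
    proof -
      have "?S {} = \<zero>\<^bsub>ideals_set R\<^esub>" by (rule S.finsum_empty)
      then show ?thesis by (simp only: ideals_set_def ring.simps)
    qed
    ultimately show ?case by simp
  next
    case (insert i A)
    have "?S (insert i A) = PIdl (a i) \<oplus>\<^bsub>ideals_set R\<^esub> ?S A"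
      by (rule S.finsum_insert) (use P insert in \<open>auto simp: ideals_set_def\<close>)
    then have eq: "?S (insert i A) = Idl (PIdl (a i) \<union> ?S A)"
      using union_genideal[OF P S] insert.prems by (simp add: ideals_set_def)
    have ai: "a i \<in> carrier R" using True insert.prems by auto
    have "PIdl (a i) \<subseteq> carrier R" "?S A \<subseteq> carrier R"
      using P[of i] S[of A] insert.prems ideal.axioms(1) additive_subgroup.a_subset by blast+
    then have "?S (insert i A) \<subseteq> K \<longleftrightarrow> PIdl (a i) \<subseteq> K \<and> ?S A \<subseteq> K"
      unfolding eq using Idl_subset_ideal[OF K] by simp
    moreover have "PIdl (a i) \<subseteq> K \<longleftrightarrow> a i \<in> K"
      using cgenideal_minimal[OF K] cgenideal_self[OF ai] by blast
    ultimately show ?case using insert by simp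
  qed
  have "?S {0..l} = carrier R \<longleftrightarrow> (\<forall>M. maximalideal M R \<longrightarrow> \<not> ?S {0..l} \<subseteq> M)"
    using exists_maximalideal_above[OF S[OF order_refl]] one_notin_maximalideal one_closed by blast
  moreover have "?S {0..l} \<subseteq> M \<longleftrightarrow> (\<forall>i \<in> {0..l}. a i \<in> M)" if "maximalideal M R" for M
    by (rule below_iff) (use maximalideal.axioms(1)[OF that] in auto)
  ultimately have "?S {0..l} = carrier R \<longleftrightarrow>
      (\<forall>M. maximalideal M R \<longrightarrow> (\<exists>j \<in> {0..l}. a j \<notin> M))" by blast
  then show ?thesis using True by (simp add: unimodular_vectors_def)
qed (simp add: unimodular_vectors_def)

text \<open>
  A single \<open>y\<close> in \<open>J\<close> has to work for all of \<open>F\<close>. Given \<open>y\<close> for part of \<open>F\<close> and a further \<open>M\<close> with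
  \<open>b \<oplus> y\<close> in \<open>M\<close>, one adds to \<open>y\<close> an element of \<open>J\<close> that lies in all earlier maximal ideals but
  not in \<open>M\<close>; as \<open>M\<close> is prime and contains neither \<open>J\<close> (else it would contain \<open>b\<close>) nor any of the other maximal ideals, the
  product of all of these is not inside \<open>M\<close>.
\<close>

lemma avoid_finitely_many_maximalideals:
  assumes "finite F" "\<And>M. M \<in> F \<Longrightarrow> maximalideal M R"
    and J: "ideal J R" and b: "b \<in> carrier R"
    and nb: "\<And>M. M \<in> F \<Longrightarrow> b \<in> M \<Longrightarrow> \<not> J \<subseteq> M"
  shows "\<exists>y \<in> J. \<forall>M \<in> F. b \<oplus> y \<notin> M"
  using assms(1,2) nb
proof (induction F rule: finite_induct)
  case empty
  then show ?case using additive_subgroup.zero_closed[OF ideal.axioms(1)[OF J]] by blast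
next
  case (insert M F)
  interpret J: ideal J R by (rule J)
  interpret M: maximalideal M R using insert.prems by simp
  interpret Mp: primeideal M R by (rule maximalideal_prime[OF M.is_maximalideal])
  obtain y where y: "y \<in> J" "\<forall>M \<in> F. b \<oplus> y \<notin> M"
    using insert.IH insert.prems by auto
  have yc: "y \<in> carrier R" using y J.Icarr by simp
  show ?case
  proof (cases "b \<oplus> y \<in> M")
    case False
    then show ?thesis using y by blast
  next
    case True
    have "\<not> J \<subseteq> M"
    proof
      assume JM: "J \<subseteq> M"
      then have "(b \<oplus> y) \<ominus> y \<in> M"
        using True y(1) M.a_closed M.a_inv_closed unfolding a_minus_def by blast
      moreover have "(b \<oplus> y) \<ominus> y = b" using b yc by algebra
      ultimately show False using insert.prems(2)[of M] JM by simp
    qed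
    let ?P = "\<Otimes>\<^bsub>ideals_set R\<^esub> N \<in> F. N"
    have FI: "\<And>N. N \<in> F \<Longrightarrow> ideal N R" using insert.prems(1) maximalideal.axioms(1) by blast
    have P: "ideal ?P R" by (rule finprod_ideals_is_ideal[OF insert.hyps(1) FI])
    have "\<not> N \<subseteq> M" if "N \<in> F" for N
      using maximalideal.I_maximal[of N R M] insert.prems(1) insert.hyps(2) that
        M.ideal_axioms M.a_subset M.I_notcarr by blast
    then have "\<not> ?P \<subseteq> M"
      using primeideal_above_finprod[where I = "\<lambda>N. N", OF insert.hyps(1) FI Mp.primeideal] by blast
    then have "\<not> J \<cdot> ?P \<subseteq> M"
      using primeideal_divides_ideal_prod[OF Mp.primeideal J P] \<open>\<not> J \<subseteq> M\<close> by blast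
    then obtain z where z: "z \<in> J" "z \<in> ?P" "z \<notin> M"
      using ideal_prod_inter[OF J P] by blast
    have zc: "z \<in> carrier R" using z J.Icarr by simp
    have diff: "(b \<oplus> (y \<oplus> z)) \<ominus> (b \<oplus> y) = z"
      using b yc zc by algebra
    have "b \<oplus> (y \<oplus> z) \<notin> M"
      using True z(3) diff M.a_closed M.a_inv_closed unfolding a_minus_def by metis
    moreover have "b \<oplus> (y \<oplus> z) \<notin> N" if N: "N \<in> F" for N
    proof -
      have "z \<in> N" using finprod_ideals_subset[where I = "\<lambda>N. N", OF insert.hyps(1) FI N] z(2) by blast
      then show ?thesis
        using ideal_diff_cong[OF FI[OF N], of "b \<oplus> (y \<oplus> z)" "b \<oplus> y"] diff y(2) N b yc zc by simp
    qed
    moreover have "y \<oplus> z \<in> J" using y z J.a_closed by simp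
    ultimately show ?thesis by blast
  qed
qed

text \<open>
  Unimodular vectors modulo \<open>I\<close> lift when only finitely many maximal ideals lie above \<open>I\<close>. With
  \<open>u = b 0 \<oplus> y\<close> a unit modulo \<open>I\<close>, \<open>y\<close> in the ideal of the other entries, and \<open>v\<close> an inverse
  of \<open>u\<close> modulo \<open>I\<close>, the entry \<open>b 1\<close> is changed by a multiple of \<open>\<one> \<ominus> v \<otimes> u\<close> so that \<open>\<one>\<close>
  becomes a combination of \<open>a 1\<close> and \<open>u\<close>, and \<open>b 0\<close> is changed so that \<open>u\<close> becomes a
  combination of the new entries. For \<open>l = 0\<close> this fails: units modulo \<open>I\<close> need not lift to units.
\<close>

lemma unimodular_vector_lift:
  assumes I: "ideal I R" and fin: "finite {M. maximalideal M R \<and> I \<subseteq> M}" and l: "l \<ge> 1"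
    and b: "\<And>j. j \<in> {0..l} \<Longrightarrow> b j \<in> carrier R"
    and unim: "\<And>M. maximalideal M R \<Longrightarrow> I \<subseteq> M \<Longrightarrow> \<exists>j \<in> {0..l}. b j \<notin> M"
  shows "\<exists>a \<in> unimodular_vectors R l. \<forall>j \<in> {0..l}. a j \<ominus> b j \<in> I"
proof -
  interpret I: ideal I R by (rule I)
  let ?J = "Idl (b ` {1..l})"
  have bJ: "b ` {1..l} \<subseteq> carrier R" using b by auto
  have J: "ideal ?J R" by (rule genideal_ideal[OF bJ])
  have b0: "b 0 \<in> carrier R" and b1: "b 1 \<in> carrier R" using b l by auto
  obtain y where y: "y \<in> ?J" "\<forall>M \<in> {M. maximalideal M R \<and> I \<subseteq> M}. b 0 \<oplus> y \<notin> M"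
  proof -
    have "\<not> ?J \<subseteq> M" if M: "maximalideal M R" "I \<subseteq> M" "b 0 \<in> M" for M
    proof
      assume "?J \<subseteq> M"
      then have "b j \<in> M" if "j \<in> {1..l}" for j using genideal_self[OF bJ] that by blast
      then have "b j \<in> M" if "j \<in> {0..l}" for j using M(3) that by (cases j) auto
      then show False using unim[OF M(1,2)] by blast
    qed
    then show thesis
      using avoid_finitely_many_maximalideals[OF fin _ J b0] that by blast
  qed
  have yc: "y \<in> carrier R" using y ideal.Icarr[OF J] by simp
  define u where "u = b 0 \<oplus> y"
  have u: "u \<in> carrier R" using b0 yc by (simp add: u_def)
  obtain v where v: "v \<in> carrier R" "\<one> \<ominus> v \<otimes> u \<in> I"
    using Units_Quot_iff_maximalideal[OF I u] Units_Quot_iff_inverse_mod[OF I u] y(2)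
    unfolding u_def by blast
  \<comment> \<open>This choice makes \<open>a1 \<oplus> (\<one> \<ominus> b 1) \<otimes> v \<otimes> u\<close> equal to \<open>\<one>\<close> exactly, not only modulo \<open>I\<close>.\<close>
  define a1 where "a1 = b 1 \<oplus> (\<one> \<ominus> b 1) \<otimes> (\<one> \<ominus> v \<otimes> u)"
  have a1: "a1 \<in> carrier R" using b1 u v by (simp add: a1_def)
  have a1b1: "a1 \<ominus> b 1 \<in> I"
  proof -
    have "a1 \<ominus> b 1 = (\<one> \<ominus> b 1) \<otimes> (\<one> \<ominus> v \<otimes> u)"
      unfolding a1_def using b1 u v(1) by algebra
    then show ?thesis using I.I_l_closed[OF v(2)] b1 by simp
  qed
  define a' where "a' = b(1 := a1)"
  have a'c: "a' j \<in> carrier R" if "j \<in> {0..l}" for j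
    using b that a1 by (simp add: a'_def)
  have a'b: "a' j \<ominus> b j \<in> I" if "j \<in> {0..l}" for j
    using a1b1 b[OF that] I.zero_closed by (simp add: a'_def minus_eq r_neg)
  let ?K = "Idl (a' ` {1..l})"
  have aK: "a' ` {1..l} \<subseteq> carrier R" using a'c by auto
  have K: "ideal ?K R" by (rule genideal_ideal[OF aK])
  \<comment> \<open>The entry \<open>b 1\<close> has changed, so \<open>y\<close> is a combination of the new entries only modulo \<open>I\<close>; the error \<open>x\<close> goes into \<open>a 0\<close>.\<close>
  have "?J \<subseteq> ?K <+> I"
  proof (rule genideal_minimal[OF add_ideals[OF K I]], rule image_subsetI)
    fix j assume j: "j \<in> {1..l}"
    have "a' j \<in> ?K" using genideal_self[OF aK] j by blast
    moreover have "\<ominus> (a' j \<ominus> b j) \<in> I" using a'b j by simp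
    moreover have "b j = a' j \<oplus> \<ominus> (a' j \<ominus> b j)"
    proof -
      have "b j \<in> carrier R" "a' j \<in> carrier R" using b a'c j by auto
      then show ?thesis by algebra
    qed
    ultimately show "b j \<in> ?K <+> I" unfolding set_add_def' by blast
  qed
  then obtain y' x where y': "y' \<in> ?K" and x: "x \<in> I" and yy': "y = y' \<oplus> x"
    using y(1) unfolding set_add_def' by blast
  have y'c: "y' \<in> carrier R" and xc: "x \<in> carrier R"
    using y' x ideal.Icarr[OF K] I.Icarr by auto
  define a where "a = restrict (a'(0 := u \<ominus> y')) {0..l}"
  have a0: "a 0 = u \<ominus> y'" and aj: "\<And>j. j \<in> {1..l} \<Longrightarrow> a j = a' j" by (auto simp: a_def)
  have "a j \<ominus> b j \<in> I" if j: "j \<in> {0..l}" for j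
  proof (cases "j = 0")
    case True
    have "u \<ominus> y' \<ominus> b 0 = x" unfolding u_def yy' using b0 y'c xc by algebra
    then show ?thesis using True x a0 by simp
  next
    case False
    then show ?thesis using a'b[OF j] aj[of j] j by simp
  qed
  moreover have "a \<in> unimodular_vectors R l"
    unfolding unimodular_vectors_iff
  proof (intro conjI allI impI)
    show "a \<in> {0..l} \<rightarrow>\<^sub>E carrier R"
      using a'c u y'c by (auto simp: a_def)
    fix M assume M: "maximalideal M R"
    interpret M: maximalideal M R by (rule M)
    show "\<exists>j \<in> {0..l}. a j \<notin> M"
    proof (rule ccontr)
      assume "\<not> ?thesis"
      then have aM: "a j \<in> M" if "j \<in> {0..l}" for j using that by blast
      have "?K \<subseteq> M"
        by (rule genideal_minimal[OF M.ideal_axioms]) (use aM aj in fastforce)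
      then have "(u \<ominus> y') \<oplus> y' \<in> M" using aM[of 0] a0 y' M.a_closed by auto
      moreover have "(u \<ominus> y') \<oplus> y' = u" using u y'c by algebra
      ultimately have "u \<in> M" by simp
      moreover have "a1 \<in> M" using aM[of 1] aj[of 1] l by (simp add: a'_def)
      ultimately have "a1 \<oplus> ((\<one> \<ominus> b 1) \<otimes> v) \<otimes> u \<in> M"
        using M.a_closed M.I_l_closed b1 v(1) by simp
      moreover have "a1 \<oplus> ((\<one> \<ominus> b 1) \<otimes> v) \<otimes> u = \<one>"
        unfolding a1_def using b1 u v(1) by algebra
      ultimately show False using one_notin_maximalideal[OF M] by simp
    qed
  qed
  ultimately show ?thesis by blast
qed

section \<open>The reduction map\<close>

text \<open>
  The case \<open>I = carrier R\<close> is subsumed: no maximal ideal lies above it, and every congruence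
  holds modulo it, so \<open>\<one>\<close> serves as the scalar.
\<close>

lemma proj_rel_iff:
  assumes I: "ideal I R"
  shows "(a, b) \<in> proj_rel R l m I \<longleftrightarrow>
    a \<in> unimodular_vectors R l \<and> b \<in> unimodular_vectors R l \<and>
    (\<exists>u \<in> carrier R. (\<forall>M. maximalideal M R \<longrightarrow> I \<subseteq> M \<longrightarrow> u \<notin> M) \<and>
      (\<forall>j \<in> {0..l}. a j \<ominus> (u [^] m j) \<otimes> b j \<in> I))"
proof -
  have "\<forall>M. maximalideal M R \<longrightarrow> I \<subseteq> M \<longrightarrow> \<one> \<notin> M" using one_notin_maximalideal by blast
  moreover have "a j \<ominus> (\<one> [^] m j) \<otimes> b j \<in> I"
    if "I = carrier R" "a \<in> unimodular_vectors R l" "b \<in> unimodular_vectors R l" "j \<in> {0..l}" for j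
  proof -
    have "a j \<in> carrier R" "b j \<in> carrier R" using that by (auto simp: unimodular_vectors_def)
    then show ?thesis using that(1) by simp
  qed
  ultimately show ?thesis
    unfolding proj_rel_def using Units_Quot_iff_maximalideal[OF I] by blast
qed

text \<open>
  This makes the reduction map well defined and injective. The scalars modulo the single ideals are
  glued by Chinese remaindering; the result is a unit modulo the product because a maximal ideal
  above the product is above one of the factors.
\<close>

lemma proj_rel_finprod_iff:
  assumes A: "finite A" "\<And>i. i \<in> A \<Longrightarrow> ideal (I i) R"
    and comax: "\<And>i j. i \<in> A \<Longrightarrow> j \<in> A \<Longrightarrow> i \<noteq> j \<Longrightarrow> I i <+> I j = carrier R"
    and ab: "a \<in> unimodular_vectors R l" "b \<in> unimodular_vectors R l"
  shows "(a, b) \<in> proj_rel R l m (\<Otimes>\<^bsub>ideals_set R\<^esub> i \<in> A. I i) \<longleftrightarrow>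
    (\<forall>i \<in> A. (a, b) \<in> proj_rel R l m (I i))"
    (is "_ \<in> proj_rel R l m ?P \<longleftrightarrow> ?all")
proof
  have P: "ideal ?P R" by (rule finprod_ideals_is_ideal[OF A])
  have "proj_rel R l m ?P \<subseteq> proj_rel R l m (I i)" if "i \<in> A" for i
    by (rule proj_rel_mono[OF P A(2)[OF that] finprod_ideals_subset[where I = I, OF A that]])
  then show ?all if "(a, b) \<in> proj_rel R l m ?P"
    using that by blast
  assume all: ?all
  have "\<exists>v. v \<in> carrier R \<and> (\<forall>M. maximalideal M R \<longrightarrow> I i \<subseteq> M \<longrightarrow> v \<notin> M) \<and>
      (\<forall>j \<in> {0..l}. a j \<ominus> (v [^] m j) \<otimes> b j \<in> I i)" if i: "i \<in> A" for i
    using bspec[OF all i] unfolding proj_rel_iff[OF A(2)[OF i]] by blast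
  then obtain w where w: "\<And>i. i \<in> A \<Longrightarrow> w i \<in> carrier R \<and>
      (\<forall>M. maximalideal M R \<longrightarrow> I i \<subseteq> M \<longrightarrow> w i \<notin> M) \<and>
      (\<forall>j \<in> {0..l}. a j \<ominus> (w i [^] m j) \<otimes> b j \<in> I i)"
    by metis
  obtain u where u: "u \<in> carrier R" "\<And>i. i \<in> A \<Longrightarrow> u \<ominus> w i \<in> I i"
    using chinese_remainder_elements[where I = I and x = w, OF A comax] w by blast
  have "u \<notin> M" if M: "maximalideal M R" "?P \<subseteq> M" for M
  proof -
    obtain i where i: "i \<in> A" "I i \<subseteq> M"
      using primeideal_above_finprod[OF A maximalideal_prime[OF M(1)] M(2)] by blast
    then show ?thesis
      using ideal_diff_cong[OF maximalideal.axioms(1)[OF M(1)] u(1), of "w i"] u(2) w M(1) by blast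
  qed
  moreover have "a j \<ominus> (u [^] m j) \<otimes> b j \<in> ?P" if j: "j \<in> {0..l}" for j
  proof -
    have c: "a j \<in> carrier R" "b j \<in> carrier R" using ab j by (auto simp: unimodular_vectors_def)
    have "a j \<ominus> (u [^] m j) \<otimes> b j \<in> I i" if i: "i \<in> A" for i
    proof -
      interpret h: ring_hom_cring R "R Quot (I i)" "(+>) (I i)"
        by (rule ideal.rcos_ring_hom_cring[OF A(2)[OF i] is_cring])
      have wi: "w i \<in> carrier R" using w i by blast
      have pow: "I i +> (v [^] n) = (I i +> v) [^]\<^bsub>R Quot (I i)\<^esub> n"
        if "v \<in> carrier R" for v and n :: nat
        using that by (induction n) simp_all
      have "I i +> u = I i +> w i"
        using minus_mem_iff_rcos_eq[OF A(2)[OF i] u(1) wi] u(2)[OF i] by blast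
      then have eq: "I i +> (u [^] m j) \<otimes> b j = I i +> (w i [^] m j) \<otimes> b j"
        using u(1) wi c by (simp only: h.hom_mult pow nat_pow_closed)
      have "a j \<ominus> (w i [^] m j) \<otimes> b j \<in> I i" using w[OF i] j by blast
      then show ?thesis
        using minus_mem_iff_rcos_eq[OF A(2)[OF i] c(1)] eq u(1) wi c(2)
        by (metis m_closed nat_pow_closed)
    qed
    then show ?thesis using finprod_eq_INT[OF A comax] c u(1) by simp
  qed
  ultimately show "(a, b) \<in> proj_rel R l m ?P"
    using proj_rel_iff[OF P] ab u(1) by blast
qed

lemma crt_reduction_bij:
  assumes I: "\<And>i. i \<in> {1..k} \<Longrightarrow> ideal (I i) R"
    and comax: "\<And>i j. i \<in> {1..k} \<Longrightarrow> j \<in> {1..k} \<Longrightarrow> i \<noteq> j \<Longrightarrow> I i <+> I j = carrier R"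
    and fin: "\<And>i. i \<in> {1..k} \<Longrightarrow> finite {M. maximalideal M R \<and> I i \<subseteq> M}"
    and l: "l \<ge> 1"
  shows "bij_betw (crt_reduction R l m k I)
    (proj_space R l m (\<Otimes>\<^bsub>ideals_set R\<^esub> i \<in> {1..k}. I i))
    (\<Pi>\<^sub>E i \<in> {1..k}. proj_space R l m (I i))"
    (is "bij_betw ?f (proj_space R l m ?P) _")
proof -
  let ?U = "unimodular_vectors R l"
  let ?r = "proj_rel R l m"
  note A = finite_atLeastAtMost[of 1 k] I
  have P: "ideal ?P R" by (rule finprod_ideals_is_ideal[OF A])
  have f: "?f (?r ?P `` {a}) = (\<lambda>i \<in> {1..k}. ?r (I i) `` {a})" if "a \<in> ?U" for a
    by (rule crt_reduction_class[OF I that])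
  have inj: "inj_on ?f (proj_space R l m ?P)"
  proof (rule inj_onI)
    fix c d assume c: "c \<in> proj_space R l m ?P" and d: "d \<in> proj_space R l m ?P" and eq: "?f c = ?f d"
    obtain a where a: "a \<in> ?U" "c = ?r ?P `` {a}"
      using c unfolding proj_space_def by (rule quotientE)
    obtain b where b: "b \<in> ?U" "d = ?r ?P `` {b}"
      using d unfolding proj_space_def by (rule quotientE)
    have "?r (I i) `` {a} = ?r (I i) `` {b}" if "i \<in> {1..k}" for i
      using fun_cong[OF eq, of i] f a b that by simp
    then have "(a, b) \<in> ?r (I i)" if "i \<in> {1..k}" for i
      using eq_equiv_class[OF _ equiv_proj_rel[OF I[OF that]] b(1)] that by blast
    then have "(a, b) \<in> ?r ?P"
      using proj_rel_finprod_iff[where I = I, OF A comax a(1) b(1)] by blast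
    then show "c = d"
      unfolding a(2) b(2) by (rule equiv_class_eq[OF equiv_proj_rel[OF P]])
  qed
  have into: "?f c \<in> (\<Pi>\<^sub>E i \<in> {1..k}. proj_space R l m (I i))" if c: "c \<in> proj_space R l m ?P" for c
  proof -
    obtain a where a: "a \<in> ?U" "c = ?r ?P `` {a}"
      using c unfolding proj_space_def by (rule quotientE)
    show ?thesis
      unfolding a(2) f[OF a(1)] proj_space_def by (auto intro: quotientI[OF a(1)])
  qed
  have onto: "g \<in> ?f ` proj_space R l m ?P" if g: "g \<in> (\<Pi>\<^sub>E i \<in> {1..k}. proj_space R l m (I i))" for g
  proof -
    have "\<exists>x \<in> ?U. g i = ?r (I i) `` {x}" if "i \<in> {1..k}" for i
      using g that unfolding proj_space_def quotient_def by (auto simp: PiE_iff)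
    then obtain x where x: "\<And>i. i \<in> {1..k} \<Longrightarrow> x i \<in> ?U \<and> g i = ?r (I i) `` {x i}" by metis
    have xc: "x i j \<in> carrier R" if "i \<in> {1..k}" "j \<in> {0..l}" for i j
      using x[OF that(1)] that(2) by (auto simp: unimodular_vectors_def)
    have "\<exists>b \<in> carrier R. \<forall>i \<in> {1..k}. b \<ominus> x i j \<in> I i" if "j \<in> {0..l}" for j
      using chinese_remainder_elements[where I = I and x = "\<lambda>i. x i j", OF A comax] xc that by blast
    then obtain b where b: "\<And>j. j \<in> {0..l} \<Longrightarrow> b j \<in> carrier R"
      "\<And>i j. j \<in> {0..l} \<Longrightarrow> i \<in> {1..k} \<Longrightarrow> b j \<ominus> x i j \<in> I i" by metis
    have above: "\<exists>i \<in> {1..k}. I i \<subseteq> M" if "maximalideal M R" "?P \<subseteq> M" for M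
      by (rule primeideal_above_finprod[OF A maximalideal_prime[OF that(1)] that(2)])
    have "finite {M. maximalideal M R \<and> ?P \<subseteq> M}"
      by (rule finite_subset[of _ "\<Union>i \<in> {1..k}. {M. maximalideal M R \<and> I i \<subseteq> M}"])
        (use above fin in auto)
    moreover have "\<exists>j \<in> {0..l}. b j \<notin> M" if M: "maximalideal M R" "?P \<subseteq> M" for M
    proof -
      obtain i where i: "i \<in> {1..k}" "I i \<subseteq> M" using above[OF M] by blast
      obtain j where j: "j \<in> {0..l}" "x i j \<notin> M"
        using x[OF i(1)] M(1) unfolding unimodular_vectors_iff by blast
      then show ?thesis
        using ideal_diff_cong[OF maximalideal.axioms(1)[OF M(1)] b(1)[OF j(1)] xc[OF i(1) j(1)]]
          b(2)[OF j(1) i(1)] i(2) by blast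
    qed
    \<comment> \<open>Now \<open>a\<close> is congruent to \<open>x i\<close> modulo each \<open>I i\<close>, hence related to it through the scalar \<open>\<one>\<close>.\<close>
    ultimately obtain a where a: "a \<in> ?U" "\<And>j. j \<in> {0..l} \<Longrightarrow> a j \<ominus> b j \<in> ?P"
      using unimodular_vector_lift[where b = b, OF P _ l b(1)] by blast
    have ac: "a j \<in> carrier R" if "j \<in> {0..l}" for j
      using a(1) that by (auto simp: unimodular_vectors_def)
    have "(a, x i) \<in> ?r (I i)" if i: "i \<in> {1..k}" for i
    proof -
      interpret Ii: ideal "I i" R by (rule I[OF i])
      have "a j \<ominus> (\<one> [^] m j) \<otimes> x i j \<in> I i" if j: "j \<in> {0..l}" for j
      proof -
        have "a j \<ominus> b j \<in> I i" using a(2)[OF j] finprod_ideals_subset[where I = I, OF A i] by blast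
        then have "(a j \<ominus> b j) \<oplus> (b j \<ominus> x i j) \<in> I i"
          using b(2)[OF j i] Ii.a_closed by simp
        moreover have "(a j \<ominus> b j) \<oplus> (b j \<ominus> x i j) = a j \<ominus> (\<one> [^] m j) \<otimes> x i j"
        proof -
          have "(a j \<ominus> b j) \<oplus> (b j \<ominus> x i j) = a j \<ominus> x i j"
            using ac[OF j] b(1)[OF j] xc[OF i j] by algebra
          then show ?thesis using xc[OF i j] by simp
        qed
        ultimately show ?thesis by simp
      qed
      then show ?thesis
        using proj_rel_iff[OF I[OF i]] a(1) x[OF i] one_notin_maximalideal by blast
    qed
    then have "g i = ?r (I i) `` {a}" if "i \<in> {1..k}" for i
      using equiv_class_eq[OF equiv_proj_rel[OF I[OF that]]] x[OF that] that by blast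
    then have "g = ?f (?r ?P `` {a})"
      unfolding f[OF a(1)] using g by (intro ext) (auto simp: PiE_iff extensional_def)
    moreover have "?r ?P `` {a} \<in> proj_space R l m ?P"
      unfolding proj_space_def by (rule quotientI[OF a(1)])
    ultimately show ?thesis by blast
  qed
  show ?thesis
    unfolding bij_betw_def using inj into onto by blast
qed

text \<open>
  A maximal ideal above the product contains some \<open>Q j\<close>, hence, being prime, its radical, and so
  equals that radical.
\<close>

lemma finite_maximalideals_above_finprod:
  assumes A: "finite A" "\<And>j. j \<in> A \<Longrightarrow> ideal (Q j) R"
    and rad: "\<And>j. j \<in> A \<Longrightarrow> maximalideal (radical R (Q j)) R"
  shows "finite {M. maximalideal M R \<and> (\<Otimes>\<^bsub>ideals_set R\<^esub> j \<in> A. Q j) \<subseteq> M}"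
proof (rule finite_subset)
  show "finite ((\<lambda>j. radical R (Q j)) ` A)" using A(1) by simp
  show "{M. maximalideal M R \<and> (\<Otimes>\<^bsub>ideals_set R\<^esub> j \<in> A. Q j) \<subseteq> M} \<subseteq> (\<lambda>j. radical R (Q j)) ` A"
  proof safe
    fix M assume M: "maximalideal M R" "(\<Otimes>\<^bsub>ideals_set R\<^esub> j \<in> A. Q j) \<subseteq> M"
    interpret M: maximalideal M R by (rule M(1))
    interpret Mp: primeideal M R by (rule maximalideal_prime[OF M(1)])
    obtain j where j: "j \<in> A" "Q j \<subseteq> M"
      using primeideal_above_finprod[OF A Mp.primeideal M(2)] by blast
    have pow: "x \<in> M" if "x \<in> carrier R" "x [^] n \<in> M" for x and n :: nat
      using that(2)
    proof (induction n)
      case 0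
      then show ?case using one_notin_maximalideal[OF M(1)] by simp
    next
      case (Suc n)
      then show ?case using Mp.I_prime[OF nat_pow_closed[OF that(1)] that(1)] by (metis nat_pow_Suc)
    qed
    then have sub: "radical R (Q j) \<subseteq> M" using j(2) unfolding radical_def by blast
    have "M = radical R (Q j)"
      using maximalideal.I_maximal[OF rad[OF j(1)] M.ideal_axioms sub M.a_subset] M.I_notcarr by simp
    then show "M \<in> (\<lambda>j. radical R (Q j)) ` A" using j(1) by blast
  qed
qed

end




theorem theoremA:
  fixes R :: "('a, 'b) ring_scheme" (structure)
    and k l :: nat
    and m :: "nat \<Rightarrow> nat"
  assumes "cring R"
    and "k \<ge> 1" and "l \<ge> 1"
    and "\<forall>j \<in> {0..l}. m j \<ge> 1"
  shows
    "(\<forall>I :: nat \<Rightarrow> 'a set.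
        (\<forall>i \<in> {1..k}. ideal (I i) R) \<and>
        (\<forall>i \<in> {1..k}. \<forall>j \<in> {1..k}. i \<noteq> j \<longrightarrow> I i <+> I j = carrier R) \<and>
        (\<forall>i \<in> {1..k}. finite {M. maximalideal M R \<and> I i \<subseteq> M})
        \<longrightarrow>
        bij_betw (crt_reduction R l m k I)
          (proj_space R l m (\<Otimes>\<^bsub>ideals_set R\<^esub> i \<in> {1..k}. I i))
          (\<Pi>\<^sub>E i \<in> {1..k}. proj_space R l m (I i)))
     \<and>
     (\<forall>(I :: nat \<Rightarrow> 'a set) (r :: nat \<Rightarrow> nat) (Q :: nat \<Rightarrow> nat \<Rightarrow> 'a set) (M :: nat \<Rightarrow> nat \<Rightarrow> 'a set).
        (\<forall>i \<in> {1..k}. ideal (I i) R) \<and>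
        (\<forall>i \<in> {1..k}. \<forall>j \<in> {1..k}. i \<noteq> j \<longrightarrow> I i <+> I j = carrier R) \<and>
        (\<forall>i \<in> {1..k}. I i = carrier R \<or>
           (r i \<ge> 1 \<and>
            (\<forall>j \<in> {1..r i}. ideal (Q i j) R \<and> maximalideal (M i j) R \<and> radical R (Q i j) = M i j) \<and>
            I i = (\<Otimes>\<^bsub>ideals_set R\<^esub> j \<in> {1..r i}. Q i j))) \<and>
        inj_on (\<lambda>(i, j). M i j) {(i, j). i \<in> {1..k} \<and> I i \<noteq> carrier R \<and> j \<in> {1..r i}}
        \<longrightarrow>
        bij_betw (crt_reduction R l m k I)
          (proj_space R l m (\<Otimes>\<^bsub>ideals_set R\<^esub> i \<in> {1..k}. I i))
          (\<Pi>\<^sub>E i \<in> {1..k}. proj_space R l m (I i)))"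
proof -
  interpret cring R by (rule assms(1))
  show ?thesis
  proof (intro conjI allI impI, goal_cases)
    case (1 I)
    show ?case by (rule crt_reduction_bij) (use 1 assms(3) in blast)+
  next
    case (2 I r Q M)
    show ?case
    proof (rule crt_reduction_bij)
      fix i assume i: "i \<in> {1..k}"
      show "finite {N. maximalideal N R \<and> I i \<subseteq> N}"
      proof (cases "I i = carrier R")
        case True
        then have "{N. maximalideal N R \<and> I i \<subseteq> N} = {}"
          using one_notin_maximalideal one_closed by blast
        then show ?thesis by (simp only: finite.emptyI)
      next
        case False
        then have Q: "\<And>j. j \<in> {1..r i} \<Longrightarrow>
            ideal (Q i j) R \<and> maximalideal (M i j) R \<and> radical R (Q i j) = M i j"
          and eq: "I i = (\<Otimes>\<^bsub>ideals_set R\<^esub> j \<in> {1..r i}. Q i j)"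
          using 2 i by blast+
        show ?thesis
          unfolding eq by (rule finite_maximalideals_above_finprod) (use Q in auto)
      qed
    qed (use 2 assms(3) in blast)+
  qed
qed

end
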